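(* Let $Y=g(X,\varepsilon)$, where $\varepsilon$ has CDF $F_\varepsilon$, let $X$ be a scalar treatment, and let $Z$ be an instrument with discrete support $\mathcal{Z}=\{z:\Pr(Z=z)\ge\delta>0\}$ of finite cardinality $|\mathcal{Z}|$. Let $V=F_{X\mid Z}(X\mid Z)$, where $V$ is independent of $Z$ and $X=Q_{X\mid Z}(V\mid Z)$ with probability one. Suppose $E[Y\mid X,V]=p(X)'q_0(V)$ for a known $J$-vector of functions $p(X)$ and an unknown $J$-vector of functional coefficients $q_0(V)$, and that the average structural function (ASF) satisfies $\mu(X)\equiv\int g(X,\varepsilon)\,dF_\varepsilon(\varepsilon)=p(X)'E[q_0(V)]$. Suppose $E[p(X)p(X)']$ is nonsingular. If $|\mathcal{Z}|<J$, then the ASF is not identified.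
   Context: $F_{X\mid Z}$ and $Q_{X\mid Z}$ are the conditional CDF and conditional quantile function of $X$ given $Z$. $J$ is finite; all expectations written are assumed to exist. ASF identification means: there is no measurable $\bar q$ (with $E[\bar q(V)]$ finite) that is observationally equivalent to $q_0$, i.e. $p(X)'\bar q(V)=p(X)'q_0(V)$ almost surely, and for which $p(X)'E[\bar q(V)]\neq p(X)'E[q_0(V)]$ with positive probability. "Not identified" is the negation. *)

theory Defs
  imports "HOL-Probability.Probability"
begin

text \<open>Conditional CDF of \<open>X\<close> given \<open>Z = z\<close>. For a discrete \<open>Z\<close> this is elementary conditioning;
  it is only meaningful where \<open>Z = z\<close> has positive probability.\<close>

definition cond_cdf :: "'a measure \<Rightarrow> ('a \<Rightarrow> real) \<Rightarrow> ('a \<Rightarrow> 'z) \<Rightarrow> real \<Rightarrow> 'z \<Rightarrow> real" where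
  "cond_cdf M X Z x z = \<P>(\<omega> in M. X \<omega> \<le> x \<bar> Z \<omega> = z)"

text \<open>For \<open>v\<close> outside the open unit interval the set below can be empty or unbounded below, and
  then \<open>Inf\<close> is an unspecified real. This concerns \<open>V = F(X | Z)\<close> only on a null set: almost
  surely \<open>V > 0\<close>, and \<open>X\<close> itself belongs to the set for \<open>v = V\<close>, \<open>z = Z\<close>.\<close>

definition cond_quantile :: "'a measure \<Rightarrow> ('a \<Rightarrow> real) \<Rightarrow> ('a \<Rightarrow> 'z) \<Rightarrow> real \<Rightarrow> 'z \<Rightarrow> real" where
  "cond_quantile M X Z v z = Inf {x. v \<le> cond_cdf M X Z x z}"

definition point_support :: "'a measure \<Rightarrow> ('a \<Rightarrow> 'z) \<Rightarrow> real \<Rightarrow> 'z set" where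
  "point_support M Z \<delta> = {z. \<P>(\<omega> in M. Z \<omega> = z) \<ge> \<delta>}"

text \<open>Integration \<open>dF\<close> against the CDF of the disturbance is integration against its law \<open>F\<close>.\<close>

definition asf :: "(real \<Rightarrow> 'e \<Rightarrow> real) \<Rightarrow> 'e measure \<Rightarrow> real \<Rightarrow> real" where
  "asf g F x = (\<integral>e. g x e \<partial>F)"

definition outer_prod :: "real ^ 'j \<Rightarrow> real ^ 'j \<Rightarrow> real ^ 'j ^ 'j" where
  "outer_prod u w = (\<chi> i k. u $ i * w $ k)"

definition second_moment :: "'a measure \<Rightarrow> ('a \<Rightarrow> real ^ 'j) \<Rightarrow> real ^ 'j ^ 'j" where
  "second_moment M W = (\<integral>\<omega>. outer_prod (W \<omega>) (W \<omega>) \<partial>M)"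

definition asf_identified ::
  "'a measure \<Rightarrow> ('a \<Rightarrow> real) \<Rightarrow> ('a \<Rightarrow> real) \<Rightarrow> (real \<Rightarrow> real ^ 'j) \<Rightarrow> (real \<Rightarrow> real ^ 'j) \<Rightarrow> bool" where
  "asf_identified M X V p q\<^sub>0 \<longleftrightarrow>
     \<not> (\<exists>q. q \<in> borel_measurable borel \<and> integrable M (\<lambda>\<omega>. q (V \<omega>)) \<and>
          (AE \<omega> in M. p (X \<omega>) \<bullet> q (V \<omega>) = p (X \<omega>) \<bullet> q\<^sub>0 (V \<omega>)) \<and>
          \<P>(\<omega> in M. p (X \<omega>) \<bullet> (\<integral>\<omega>'. q (V \<omega>') \<partial>M) \<noteq> p (X \<omega>) \<bullet> (\<integral>\<omega>'. q\<^sub>0 (V \<omega>') \<partial>M)) > 0)"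

end

theory Submission
  imports Defs
begin

text \<open>For each \<open>v\<close> the vectors \<open>p (Q (v | z))\<close>, with \<open>z\<close> in the support of \<open>Z\<close>, span a proper
  subspace of the \<open>J\<close>-dimensional space. Let \<open>P v\<close> be the orthogonal projection onto the complement
  of this subspace. Adding a column \<open>P v b\<close> to \<open>q\<^sub>0 v\<close> does not change \<open>p (X) \<bullet> q\<^sub>0 (V)\<close>.
  The trace of \<open>P v\<close> is at least \<open>1\<close>, so some column has nonzero mean, and by nonsingularity of
  the second moment matrix this mean is visible in the ASF. Gram--Schmidt gives
  an explicit formula for \<open>P v\<close>, from which measurability in \<open>v\<close> is immediate.\<close>

section \<open>Projection onto the orthogonal complement of a list of vectors\<close>

text \<open>A vector that already depends on its successors has residual \<open>0\<close>; then the quotient is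
  \<open>0 / 0 = 0\<close> and the vector is ignored.\<close>

fun gs_residual :: "'a::real_inner list \<Rightarrow> 'a \<Rightarrow> 'a" where
  "gs_residual [] x = x"
| "gs_residual (a # as) x = gs_residual as x -
     ((gs_residual as x \<bullet> gs_residual as a) / (gs_residual as a \<bullet> gs_residual as a)) *\<^sub>R gs_residual as a"

text \<open>The residual map is a symmetric idempotent, and this one identity packs both facts into
  a form that survives induction: expanding either side leaves \<open>u \<bullet> w - (u \<bullet>
  n) * (n \<bullet> w) / (n \<bullet> n)\<close>.\<close>

lemma gs_residual_inner: "gs_residual as x \<bullet> y = gs_residual as x \<bullet> gs_residual as y"
proof (induction as arbitrary: x y)
  case Nil
  show ?case by simp
next
  case (Cons a as)
  define u w n where "u = gs_residual as x" and "w = gs_residual as y" and "n = gs_residual as a"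
  have 1: "u \<bullet> y = u \<bullet> w" "n \<bullet> y = n \<bullet> w"
    using Cons.IH by (auto simp: u_def w_def n_def)
  show ?case
    unfolding gs_residual.simps u_def[symmetric] w_def[symmetric] n_def[symmetric]
    by (cases "n = 0") (auto simp: 1 inner_diff_left inner_diff_right inner_commute)
qed

lemma gs_residual_orthogonal: "b \<in> set as \<Longrightarrow> b \<bullet> gs_residual as x = 0"
proof (induction as arbitrary: x)
  case Nil
  then show ?case by simp
next
  case (Cons a as)
  show ?case
  proof (cases "b = a")
    case True
    \<comment> \<open>By symmetry, pairing a residual with \<open>a\<close> amounts to pairing it
      with the residual of \<open>a\<close>, so the subtracted component cancels exactly.\<close>
    have "a \<bullet> gs_residual as y = gs_residual as y \<bullet> gs_residual as a" for y
      using gs_residual_inner[of as y a] by (simp add: inner_commute)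
    then show ?thesis
      using True by (cases "gs_residual as a = 0") (auto simp: inner_diff_right)
  next
    case False
    then show ?thesis
      using Cons by (simp add: inner_diff_right)
  qed
qed

text \<open>The squared norm of the residual is its inner product with \<open>x\<close>, so
  Cauchy-Schwarz applies. The bound later gives integrability.\<close>

lemma norm_gs_residual_le: "norm (gs_residual as x) \<le> norm x"
proof -
  have "norm (gs_residual as x) * norm (gs_residual as x) = gs_residual as x \<bullet> x"
    by (metis gs_residual_inner power2_norm_eq_inner power2_eq_square)
  also have "\<dots> \<le> norm (gs_residual as x) * norm x"
    by (rule norm_cauchy_schwarz)
  finally show ?thesis
    by (cases "gs_residual as x = 0") auto
qed

text \<open>Each vector removes a projection along its residual \<open>n\<close>, of trace
  \<open>(n \<bullet> n) / (n \<bullet> n)\<close>, which is 1, or 0 when \<open>n = 0\<close>. So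
  each list entry costs at most one dimension.\<close>

lemma trace_gs_residual_ge:
  fixes as :: "'a::euclidean_space list"
  shows "(\<Sum>b\<in>Basis. gs_residual as b \<bullet> b) \<ge> real DIM('a) - real (length as)"
proof (induction as)
  case Nil
  show ?case by (simp add: inner_Basis)
next
  case (Cons a as)
  define n where "n = gs_residual as a"
  have 1: "gs_residual as b \<bullet> n = n \<bullet> b" for b
    unfolding n_def using gs_residual_inner[of as a b] by (simp add: inner_commute)
  have "(\<Sum>b\<in>Basis. (gs_residual as b \<bullet> n) / (n \<bullet> n) * (n \<bullet> b)) = (n \<bullet> n) / (n \<bullet> n)"
    by (subst (3) euclidean_inner) (simp add: 1 sum_divide_distrib)
  also have "\<dots> \<le> 1" by simp
  finally show ?case
    using Cons by (simp add: n_def[symmetric] inner_diff_left sum_subtractf)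
qed

lemma borel_measurable_gs_residual:
  fixes h :: "'b \<Rightarrow> 'a::euclidean_space"
  assumes "\<And>f. f \<in> set fs \<Longrightarrow> f \<in> borel_measurable M" and "h \<in> borel_measurable M"
  shows "(\<lambda>v. gs_residual (map (\<lambda>f. f v) fs) (h v)) \<in> borel_measurable M"
  using assms
proof (induction fs arbitrary: h)
  case Nil
  then show ?case by simp
next
  case (Cons f fs)
  \<comment> \<open>The recursion evaluates the residual at the head \<open>f\<close> as well as at
    \<open>h\<close>, hence the induction over arbitrary \<open>h\<close>.\<close>
  have [measurable]: "(\<lambda>v. gs_residual (map (\<lambda>f. f v) fs) (h v)) \<in> borel_measurable M"
    "(\<lambda>v. gs_residual (map (\<lambda>f. f v) fs) (f v)) \<in> borel_measurable M"
    using Cons by auto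
  show ?case by simp
qed

section \<open>Conditional distribution and quantile functions\<close>

lemma pred_eq_t1 [measurable]:
  fixes Z :: "'a \<Rightarrow> 'z::t1_space"
  assumes [measurable]: "Z \<in> borel_measurable M"
  shows "Measurable.pred M (\<lambda>\<omega>. Z \<omega> = z)"
proof -
  have "Z -` {z} \<inter> space M \<in> sets M"
    by (rule measurable_sets[OF assms]) simp
  then show ?thesis
    by (simp add: pred_def vimage_def Int_def conj_commute)
qed

text \<open>Conditioning on an event of positive probability gives a uniform measure, and
  \<open>N\<close> is the law of \<open>X\<close> under it.\<close>

lemma cond_cdf_eq_cdf:
  fixes Z :: "'a \<Rightarrow> 'z::t1_space"
  assumes "prob_space M" and [measurable]: "X \<in> borel_measurable M" "Z \<in> borel_measurable M"
    and pos: "\<P>(\<omega> in M. Z \<omega> = z) \<noteq> 0"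
  obtains N where "real_distribution N" "\<And>x. cond_cdf M X Z x z = cdf N x"
proof
  interpret prob_space M by fact
  define U where "U = uniform_measure M {\<omega> \<in> space M. Z \<omega> = z}"
  have [measurable_cong, simp]: "sets U = sets M" by (simp add: U_def)
  have "prob_space U"
    unfolding U_def using pos by (intro prob_space_uniform_measure) (auto simp: measure_def)
  then show "real_distribution (distr U borel X)"
    by (intro prob_space.real_distribution_distr) auto
  have "{\<omega> \<in> space U. X \<omega> \<le> x} = X -` {..x} \<inter> space U" for x
    by auto
  moreover have "cond_cdf M X Z x z = \<P>(\<omega> in U. X \<omega> \<le> x)" for x
    unfolding cond_cdf_def U_def by (rule measure_uniform_measure_eq_cond_prob[symmetric]) simp_all
  ultimately show "cond_cdf M X Z x z = cdf (distr U borel X) x" for x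
    unfolding cdf_def by (simp add: measure_distr)
qed

lemma borel_measurable_cond_cdf:
  fixes Z :: "'a \<Rightarrow> 'z::t1_space"
  assumes "prob_space M" "X \<in> borel_measurable M" "Z \<in> borel_measurable M"
    and "\<P>(\<omega> in M. Z \<omega> = z) \<noteq> 0"
  shows "(\<lambda>x. cond_cdf M X Z x z) \<in> borel_measurable borel"
proof -
  obtain N where N: "real_distribution N" "\<And>x. cond_cdf M X Z x z = cdf N x"
    using cond_cdf_eq_cdf[OF assms] by blast
  interpret cdf_distribution N
    using N(1) by (simp add: cdf_distribution_def)
  show ?thesis
    unfolding N(2) by (rule measurable_C)
qed

text \<open>On the open unit interval the quantile is the generalized inverse of a CDF. Elsewhere
  \<open>Inf\<close> may be unspecified, but it is constant on \<open>v \<le> 0\<close> and on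
  \<open>v > 1\<close>, and \<open>v = 1\<close> is a single point.\<close>

lemma borel_measurable_cond_quantile:
  fixes Z :: "'a \<Rightarrow> 'z::t1_space"
  assumes "prob_space M" "X \<in> borel_measurable M" "Z \<in> borel_measurable M"
    and "\<P>(\<omega> in M. Z \<omega> = z) \<noteq> 0"
  shows "(\<lambda>v. cond_quantile M X Z v z) \<in> borel_measurable borel"
proof -
  obtain N where N: "real_distribution N" "\<And>x. cond_cdf M X Z x z = cdf N x"
    using cond_cdf_eq_cdf[OF assms] by blast
  interpret cdf_distribution N
    using N(1) by (simp add: cdf_distribution_def)
  define Q where "Q v = Inf {x. v \<le> cdf N x}" for v
  have low: "Q v = Inf UNIV" if "v \<le> 0" for v
    using that order_trans[OF that cdf_nonneg] by (simp add: Q_def)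
  have high: "Q v = Inf {}" if "v > 1" for v
  proof -
    have "\<not> v \<le> cdf N x" for x using that cdf_bounded_prob[of x] by linarith
    then show ?thesis by (simp add: Q_def)
  qed
  have "Q \<in> borel_measurable borel"
  proof (rule measurable_piecewise_restrict[where C = "{{..0}, {0<..<1}, {1}, {1<..}}"])
    fix A :: "real set" assume "A \<in> {{..0}, {0<..<1}, {1}, {1<..}}"
    moreover have "Q \<in> borel_measurable (restrict_space borel {..0})"
      by (subst measurable_cong[where g = "\<lambda>_. Inf UNIV"]) (auto simp: space_restrict_space low)
    moreover have "Q \<in> borel_measurable (restrict_space borel {1})"
      by (subst measurable_cong[where g = "\<lambda>_. Q 1"]) (auto simp: space_restrict_space)
    moreover have "Q \<in> borel_measurable (restrict_space borel {1<..})"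
      by (subst measurable_cong[where g = "\<lambda>_. Inf {}"]) (auto simp: space_restrict_space high)
    moreover have "Q \<in> borel_measurable (restrict_space borel {0<..<1})"
      unfolding Q_def[abs_def] by (rule measurable_CI)
    ultimately show "Q \<in> borel_measurable (restrict_space borel A)"
      by blast
  next
    show "space borel \<subseteq> \<Union>{{..0}, {0<..<1}, {1}, {1<..} :: real set}"
      by force
  qed auto
  then show ?thesis
    unfolding cond_quantile_def N(2) Q_def[abs_def] .
qed

lemma borel_measurable_control_variable:
  fixes Z :: "'a \<Rightarrow> 'z::t1_space"
  assumes "prob_space M" and [measurable]: "X \<in> borel_measurable M" "Z \<in> borel_measurable M"
    and "\<delta> > 0" "AE \<omega> in M. Z \<omega> \<in> point_support M Z \<delta>" "finite (point_support M Z \<delta>)"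
  shows "(\<lambda>\<omega>. cond_cdf M X Z (X \<omega>) (Z \<omega>)) \<in> borel_measurable M"
proof -
  interpret prob_space M by fact
  let ?S = "point_support M Z \<delta>"
  \<comment> \<open>Lying outside the support only bounds the mass of \<open>z\<close> by \<delta>;
    almost sure membership of \<open>Z\<close> in the support makes it zero.\<close>
  have null: "\<P>(\<omega> in M. Z \<omega> = z) = 0" if "z \<notin> ?S" for z
  proof -
    have "AE \<omega> in M. Z \<omega> \<noteq> z"
      using assms(5) by eventually_elim (use that in auto)
    then show ?thesis
      by (subst prob_Collect_eq_0) auto
  qed
  have [measurable]: "(\<lambda>x. cond_cdf M X Z x z) \<in> borel_measurable borel" if "z \<in> ?S" for z
    using that \<open>\<delta> > 0\<close> by (intro borel_measurable_cond_cdf assms(1-3)) (auto simp: point_support_def)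
  have "(\<lambda>\<omega>. \<Sum>z\<in>?S. if Z \<omega> = z then cond_cdf M X Z (X \<omega>) z else 0) \<in> borel_measurable M"
    by (intro borel_measurable_sum) measurable
  \<comment> \<open>Off the support the conditional probability is \<open>0 / 0 = 0\<close>, so the
    two functions agree everywhere, not merely almost everywhere.\<close>
  also have "(\<lambda>\<omega>. \<Sum>z\<in>?S. if Z \<omega> = z then cond_cdf M X Z (X \<omega>) z else 0)
      = (\<lambda>\<omega>. cond_cdf M X Z (X \<omega>) (Z \<omega>))"
    using assms(6) by (auto simp: fun_eq_iff null cond_cdf_def cond_prob_def)
  finally show ?thesis .
qed

section \<open>Non-identification\<close>

text \<open>\<open>second_moment M W *v c\<close> is the mean of
  \<open>(W \<omega> \<bullet> c) *\<^sub>R W \<omega>\<close>, hence zero under almost sure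
  orthogonality; invertibility then forces \<open>c = 0\<close>.\<close>

lemma invertible_second_moment_not_AE_orthogonal:
  fixes W :: "'a \<Rightarrow> real ^ 'j"
  assumes int: "integrable M (\<lambda>\<omega>. outer_prod (W \<omega>) (W \<omega>))"
    and inv: "invertible (second_moment M W)" and "c \<noteq> 0"
  shows "\<not> (AE \<omega> in M. W \<omega> \<bullet> c = 0)"
proof
  assume orth: "AE \<omega> in M. W \<omega> \<bullet> c = 0"
  have "linear (\<lambda>A :: real ^ 'j ^ 'j. A *v c)"
    by (rule linearI) (simp_all add: matrix_vector_mult_add_rdistrib scaleR_matrix_vector_assoc)
  then have "bounded_linear (\<lambda>A :: real ^ 'j ^ 'j. A *v c)"
    by (simp add: linear_conv_bounded_linear)
  then have "second_moment M W *v c = (\<integral>\<omega>. outer_prod (W \<omega>) (W \<omega>) *v c \<partial>M)"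
    unfolding second_moment_def using int by (rule integral_bounded_linear[symmetric])
  also have "outer_prod u u *v c = (u \<bullet> c) *\<^sub>R u" for u :: "real ^ 'j"
    by (simp add: vec_eq_iff outer_prod_def matrix_vector_mult_def inner_vec_def sum_distrib_left
        mult_ac)
  then have "(\<integral>\<omega>. outer_prod (W \<omega>) (W \<omega>) *v c \<partial>M) = 0"
    by (intro integral_eq_zero_AE) (use orth in auto)
  finally have "second_moment M W *v c = 0" .
  moreover obtain B where "B ** second_moment M W = mat 1"
    using inv by (auto simp: invertible_def)
  ultimately have "c = 0"
    by (metis matrix_vector_mul_assoc matrix_vector_mul_lid matrix_vector_mult_0_right)
  with \<open>c \<noteq> 0\<close> show False by simp
qed


theorem theorem9:
  fixes M :: "'a measure" and E :: "'e measure" and F\<^sub>\<epsilon> :: "'e measure"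
    and X V Y :: "'a \<Rightarrow> real" and Z :: "'a \<Rightarrow> 'z :: t1_space" and \<epsilon> :: "'a \<Rightarrow> 'e"
    and g :: "real \<Rightarrow> 'e \<Rightarrow> real" and p q\<^sub>0 :: "real \<Rightarrow> real ^ 'j" and \<delta> :: real
  assumes "prob_space M"
    and "X \<in> borel_measurable M" and "Z \<in> borel_measurable M" and "\<epsilon> \<in> M \<rightarrow>\<^sub>M E"
    and "F\<^sub>\<epsilon> = distr M E \<epsilon>"
    and "case_prod g \<in> borel_measurable (borel \<Otimes>\<^sub>M E)"
    and "\<And>\<omega>. \<omega> \<in> space M \<Longrightarrow> Y \<omega> = g (X \<omega>) (\<epsilon> \<omega>)"
    and "\<delta> > 0" and "AE \<omega> in M. Z \<omega> \<in> point_support M Z \<delta>" and "finite (point_support M Z \<delta>)"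
    and "\<And>\<omega>. \<omega> \<in> space M \<Longrightarrow> V \<omega> = cond_cdf M X Z (X \<omega>) (Z \<omega>)"
    and "prob_space.indep_set M
           (sets (vimage_algebra (space M) V borel)) (sets (vimage_algebra (space M) Z borel))"
    and "AE \<omega> in M. X \<omega> = cond_quantile M X Z (V \<omega>) (Z \<omega>)"
    and "p \<in> borel_measurable borel" and "q\<^sub>0 \<in> borel_measurable borel"
    and "integrable M Y" and "integrable M (\<lambda>\<omega>. q\<^sub>0 (V \<omega>))"
    and "AE \<omega> in M.
           real_cond_exp M (vimage_algebra (space M) (\<lambda>\<omega>. (X \<omega>, V \<omega>)) borel) Y \<omega>
             = p (X \<omega>) \<bullet> q\<^sub>0 (V \<omega>)"
    and "AE \<omega> in M. integrable F\<^sub>\<epsilon> (g (X \<omega>))"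
    and "AE \<omega> in M. asf g F\<^sub>\<epsilon> (X \<omega>) = p (X \<omega>) \<bullet> (\<integral>\<omega>'. q\<^sub>0 (V \<omega>') \<partial>M)"
    and "integrable M (\<lambda>\<omega>. outer_prod (p (X \<omega>)) (p (X \<omega>)))"
    and "invertible (second_moment M (\<lambda>\<omega>. p (X \<omega>)))"
    and "card (point_support M Z \<delta>) < CARD('j)"
  shows "\<not> asf_identified M X V p q\<^sub>0"
proof -
  interpret prob_space M by fact
  note [measurable] = \<open>X \<in> borel_measurable M\<close> \<open>p \<in> borel_measurable borel\<close>
    \<open>q\<^sub>0 \<in> borel_measurable borel\<close>
  let ?S = "point_support M Z \<delta>"
  have "V \<in> borel_measurable M \<longleftrightarrow> (\<lambda>\<omega>. cond_cdf M X Z (X \<omega>) (Z \<omega>)) \<in> borel_measurable M"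
    by (rule measurable_cong) (fact assms(11))
  then have [measurable]: "V \<in> borel_measurable M"
    using borel_measurable_control_variable[OF assms(1-3,8-10)] by simp
  obtain zs where zs: "set zs = ?S" "length zs = card ?S"
    using finite_distinct_list[OF assms(10)] distinct_card by metis
  \<comment> \<open>These are the candidate values of \<open>p (X \<omega>)\<close> given
    \<open>V \<omega> = v\<close>, one per support point.\<close>
  define fs where "fs = map (\<lambda>z v. p (cond_quantile M X Z v z)) zs"
  have fs: "f \<in> borel_measurable borel" if f_in: "f \<in> set fs" for f
  proof -
    obtain z where z: "z \<in> ?S" and f: "f = (\<lambda>v. p (cond_quantile M X Z v z))"
      using f_in zs by (auto simp: fs_def)
    have [measurable]: "(\<lambda>v. cond_quantile M X Z v z) \<in> borel_measurable borel"
      using z assms(8)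
      by (intro borel_measurable_cond_quantile assms(1-3)) (auto simp: point_support_def)
    show ?thesis unfolding f by measurable
  qed
  define P where "P b v = gs_residual (map (\<lambda>f. f v) fs) b" for b v
  have [measurable]: "P b \<in> borel_measurable borel" for b
    unfolding P_def by (rule borel_measurable_gs_residual[OF fs]) auto
  have int_P: "integrable M (\<lambda>\<omega>. P b (V \<omega>))" for b
  proof (rule integrable_const_bound[where B = "norm b"])
    show "AE \<omega> in M. norm (P b (V \<omega>)) \<le> norm b"
      by (simp add: P_def norm_gs_residual_le)
  qed measurable
  have orth: "AE \<omega> in M. p (X \<omega>) \<bullet> P b (V \<omega>) = 0" for b
    using assms(9,13)
  proof eventually_elim
    case (elim \<omega>)
    \<comment> \<open>The quantile representation at the realised \<open>Z \<omega>\<close> puts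
      \<open>p (X \<omega>)\<close> in the list.\<close>
    have "p (X \<omega>) \<in> set (map (\<lambda>f. f (V \<omega>)) fs)"
      using elim(1) by (subst elim(2)) (auto simp: fs_def zs)
    then show ?case
      unfolding P_def by (rule gs_residual_orthogonal)
  qed
  have "1 \<le> (\<integral>\<omega>. (\<Sum>b\<in>Basis. P b (V \<omega>) \<bullet> b) \<partial>M)"
  proof -
    \<comment> \<open>\<open>CARD('j)\<close> minus the number of vectors is a positive integer, so
      the trace is at least 1 for every \<open>v\<close>.\<close>
    have "1 \<le> (\<Sum>b\<in>Basis. P b v \<bullet> b)" for v
      using trace_gs_residual_ge[of "map (\<lambda>f. f v) fs"] assms(23) by (simp add: P_def fs_def zs)
    then have "(\<integral>\<omega>. 1 \<partial>M) \<le> (\<integral>\<omega>. (\<Sum>b\<in>Basis. P b (V \<omega>) \<bullet> b) \<partial>M)"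
      by (intro integral_mono) (auto intro!: int_P)
    then show ?thesis by (simp add: prob_space)
  qed
  also have "\<dots> = (\<Sum>b\<in>Basis. (\<integral>\<omega>. P b (V \<omega>) \<partial>M) \<bullet> b)"
    by (subst Bochner_Integration.integral_sum) (auto simp: int_P)
  \<comment> \<open>If all these means vanished, the sum would be 0, below its lower bound
    1.\<close>
  finally obtain b where b: "(\<integral>\<omega>. P b (V \<omega>) \<partial>M) \<noteq> 0"
    by (metis (no_types, lifting) inner_zero_left not_one_le_zero sum.neutral)
  define q where "q v = q\<^sub>0 v + P b v" for v
  have "q \<in> borel_measurable borel"
    unfolding q_def by measurable
  moreover have "integrable M (\<lambda>\<omega>. q (V \<omega>))"
    unfolding q_def using assms(17) int_P by (rule Bochner_Integration.integrable_add)
  moreover have "AE \<omega> in M. p (X \<omega>) \<bullet> q (V \<omega>) = p (X \<omega>) \<bullet> q\<^sub>0 (V \<omega>)"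
    using orth[of b] by eventually_elim (simp add: q_def inner_add_right)
  moreover have "\<P>(\<omega> in M. p (X \<omega>) \<bullet> (\<integral>\<omega>'. q (V \<omega>') \<partial>M) \<noteq> p (X \<omega>) \<bullet> (\<integral>\<omega>'. q\<^sub>0 (V \<omega>') \<partial>M)) > 0"
  proof -
    have "(\<integral>\<omega>. q (V \<omega>) \<partial>M) = (\<integral>\<omega>. q\<^sub>0 (V \<omega>) \<partial>M) + (\<integral>\<omega>. P b (V \<omega>) \<partial>M)"
      unfolding q_def using assms(17) int_P by (rule Bochner_Integration.integral_add)
    \<comment> \<open>The two structural functions differ by exactly this inner product, which
      nonsingularity keeps from vanishing almost surely.\<close>
    moreover have "\<P>(\<omega> in M. p (X \<omega>) \<bullet> (\<integral>\<omega>'. P b (V \<omega>') \<partial>M) \<noteq> 0) \<noteq> 0"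
      using invertible_second_moment_not_AE_orthogonal[OF assms(21,22) b]
      by (subst prob_Collect_eq_0) auto
    ultimately show ?thesis
      by (simp add: inner_add_right zero_less_measure_iff)
  qed
  ultimately show ?thesis
    unfolding asf_identified_def by blast
qed

end
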